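(* Let $n\ge 1$ be an integer, let $U$ be a finite set (the universe) with real weights $(w_u)_{u\in U}$, $w_u\ge 0$, let $U_i\subseteq U$ for each $i\in[n]=\{1,\dots,n\}$, and let $\kappa\ge 0$ be real. Assume that $\kappa$ and the weights become integers after a common scaling, i.e. there is a real $s>0$ such that $s\kappa\in\mathbb{Z}$ and $s\,w_u\in\mathbb{Z}$ for all $u\in U$. Define the saturated coverage function $f_{\mathrm{sat}}:2^{[n]}\to\mathbb{R}_{\ge 0}$ by $$f_{\mathrm{sat}}(A)=\min\Big(\sum_{u\in\bigcup_{i\in A}U_i}w_u,\ \kappa\Big),\qquad A\subseteq[n].$$ Then $f_{\mathrm{sat}}$ is entropic up to a constant factor.
   Context: A set function $f:2^{[n]}\to\mathbb{R}_{\ge 0}$ is called entropic if there exist jointly distributed (discrete) random variables $X_1,\dots,X_n$ such that $f(A)=H(X_A)$ for all $A\subseteq[n]$, where $X_A=(X_i)_{i\in A}$ and $H$ denotes (joint) Shannon entropy, with $H(X_\emptyset)=0$. A set function $f$ is entropic up to a constant factor if there is a constant $c>0$ such that $c\cdot f$ is entropic. *)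

theory Defs
  imports "HOL-Probability.Probability"
begin

definition subfamily :: "(nat \<Rightarrow> 'a \<Rightarrow> 'v) \<Rightarrow> nat set \<Rightarrow> 'a \<Rightarrow> nat \<Rightarrow> 'v" where
  "subfamily X A = (\<lambda>\<omega>. \<lambda>i\<in>A. X i \<omega>)"

context information_space
begin

(* The library entropy is a Bochner integral and equals 0 when that integral diverges,
   so finiteness of the entropy has to be required separately. *)
definition has_entropy :: "('a \<Rightarrow> 'v) \<Rightarrow> real \<Rightarrow> bool" where
  "has_entropy Y h \<longleftrightarrow>
     (\<exists>P. finite_entropy (count_space (Y ` space M)) Y P) \<and> \<H>(Y) = h"

end

(* Discrete random variables take countably many values, which may be relabelled by natural
   numbers without changing any joint entropy. The joint law of n such variables lives on
   functions from {1..n} to nat, so fixing the sample space to have type nat => nat loses no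
   joint distribution. Entropy is measured in bits. *)
definition entropic :: "nat \<Rightarrow> (nat set \<Rightarrow> real) \<Rightarrow> bool" where
  "entropic n f \<longleftrightarrow>
     (\<exists>(M :: (nat \<Rightarrow> nat) measure) (X :: nat \<Rightarrow> (nat \<Rightarrow> nat) \<Rightarrow> nat).
        information_space M 2 \<and>
        (\<forall>i\<in>{1..n}. X i \<in> M \<rightarrow>\<^sub>M count_space UNIV) \<and>
        (\<forall>A\<subseteq>{1..n}. information_space.has_entropy M 2 (subfamily X A) (f A)))"

definition entropic_up_to_constant :: "nat \<Rightarrow> (nat set \<Rightarrow> real) \<Rightarrow> bool" where
  "entropic_up_to_constant n f \<longleftrightarrow> (\<exists>c>0. entropic n (\<lambda>A. c * f A))"

definition saturated_coverage ::
    "('u \<Rightarrow> real) \<Rightarrow> (nat \<Rightarrow> 'u set) \<Rightarrow> real \<Rightarrow> nat set \<Rightarrow> real" where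
  "saturated_coverage w V \<kappa> A = min (\<Sum>u\<in>(\<Union>i\<in>A. V i). w u) \<kappa>"

end

(* After scaling, the capacity kappa and the weights are natural numbers k and m u. Give every u
   its own block of m u points of a prime field with more than k + sum m elements, choose a
   uniformly random polynomial of degree less than k, and let X_i be the tuple of its values at
   the points belonging to V i. Any k values at distinct points determine the polynomial and
   are arbitrary (a Reed-Solomon code), so the values at t points carry min t k * log p bits. *)
theory Submission
  imports Defs "HOL-Computational_Algebra.Polynomial" "HOL-Computational_Algebra.Primes"
begin

section \<open>Entropy of a variable with equal fibres\<close>

lemma information_space_uniform_count_measure:
  assumes "finite \<Omega>" and "\<Omega> \<noteq> {}" and "b > 1"
  shows "information_space (uniform_count_measure \<Omega>) b"
proof -
  interpret prob_space "uniform_count_measure \<Omega>"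
    using assms by (intro prob_space_uniform_count_measure)
  show ?thesis
    using assms by unfold_locales
qed

text \<open>Equal fibres make \<open>Y\<close> uniform on its image, which has
  \<open>card \<Omega> / m\<close> elements; the entropy is the logarithm of that number.\<close>

lemma has_entropy_equal_fibres:
  assumes fin: "finite \<Omega>" and ne: "\<Omega> \<noteq> {}" and b: "b > 1"
    and fibre: "\<And>\<omega>. \<omega> \<in> \<Omega> \<Longrightarrow> card {\<omega>' \<in> \<Omega>. Y \<omega>' = Y \<omega>} = m"
  shows "information_space.has_entropy (uniform_count_measure \<Omega>) b Y
           (log b (real (card \<Omega>) / real m))"
proof -
  define M where "M = uniform_count_measure \<Omega>"
  interpret information_space M b
    unfolding M_def by (rule information_space_uniform_count_measure[OF fin ne b])
  have space [simp]: "space M = \<Omega>"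
    by (simp add: M_def space_uniform_count_measure)
  have sf: "simple_function M Y"
    using fin by (auto simp: simple_function_def M_def sets_uniform_count_measure
        space_uniform_count_measure)
  define q where "q = real m / real (card \<Omega>)"
  have prob_fibre: "prob (Y -` {y} \<inter> space M) = q" if y: "y \<in> Y ` space M" for y
  proof -
    obtain \<omega> where \<omega>: "\<omega> \<in> \<Omega>" "y = Y \<omega>"
      using y unfolding space by blast
    have "prob (Y -` {y} \<inter> space M) = real (card (Y -` {y} \<inter> \<Omega>)) / real (card \<Omega>)"
      unfolding space unfolding M_def by (subst measure_uniform_count_measure) (use fin in auto)
    also have "Y -` {y} \<inter> \<Omega> = {\<omega>' \<in> \<Omega>. Y \<omega>' = Y \<omega>}"
      using \<omega> by auto
    finally show ?thesis
      using fibre[OF \<omega>(1)] by (simp add: q_def)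
  qed
  have sd: "simple_distributed M Y (\<lambda>_. q)"
    by (rule simple_distributedI[OF sf _ prob_fibre[symmetric]]) (simp_all add: q_def)
  have "(\<Sum>y\<in>Y ` space M. q) = 1"
    using simple_distributed_sum_space[OF sd] by simp
  \<comment> \<open>Total probability 1 replaces a separate count of the values of \<open>Y\<close>,
    and it also excludes \<open>q = 0\<close>.\<close>
  hence total: "real (card (Y ` \<Omega>)) * q = 1"
    by simp
  have "entropy b (count_space (Y ` space M)) Y = - (\<Sum>y\<in>Y ` space M. q * log b q)"
    by (rule entropy_simple_distributed[OF sd])
  also have "\<dots> = - (real (card (Y ` \<Omega>)) * q) * log b q"
    by simp
  also have "\<dots> = - log b q"
    unfolding total by simp
  also have "\<dots> = log b (real (card \<Omega>) / real m)"
  proof -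
    have "q \<noteq> 0"
      using total by auto
    hence "q > 0"
      by (simp add: q_def)
    thus ?thesis
      using log_recip[of b q] by (simp add: q_def)
  qed
  finally have "has_entropy Y (log b (real (card \<Omega>) / real m))"
    using finite_entropy_simple_function[OF sf] unfolding has_entropy_def by blast
  thus ?thesis
    by (simp add: M_def)
qed

section \<open>Reed-Solomon codes\<close>

text \<open>A nonzero polynomial over a field has no more roots than its degree. Here the field is
  that of residues modulo \<open>p\<close>, phrased inside \<open>int\<close>: split off one linear
  factor per root and induct.\<close>

lemma const_poly_dvd_if_many_roots_mod_prime:
  fixes P :: "int poly"
  assumes p: "prime p" and "finite S" and "inj_on (\<lambda>x. x mod p) S" and "degree P < card S"
    and "\<And>x. x \<in> S \<Longrightarrow> p dvd poly P x"
  shows "[:p:] dvd P"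
  using assms(2-)
proof (induction S arbitrary: P rule: finite_induct)
  case empty
  thus ?case by simp
next
  case (insert a S)
  define Q where "Q = synthetic_div P a"
  have P: "P = [:-a, 1:] * Q + [:poly P a:]"
    using synthetic_div_correct'[of a P] by (simp add: Q_def)
  have "[:p:] dvd [:poly P a:]"
    using insert.prems(3)[of a] by simp
  moreover have "[:p:] dvd Q"
  \<comment> \<open>Constants are separate because their degree cannot drop: for empty
    \<open>S\<close> the bound \<open>degree Q < card S\<close> would fail.\<close>
  proof (cases "degree P = 0")
    case True
    hence "Q = 0"
      by (simp add: Q_def synthetic_div_eq_0_iff)
    thus ?thesis
      by simp
  next
    case False
    show ?thesis
    proof (rule insert.IH)
      show "inj_on (\<lambda>x. x mod p) S"
        using insert.prems(1) by auto
      show "degree Q < card S"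
        using insert.prems(2) insert.hyps False by (simp add: Q_def degree_synthetic_div)
      fix x assume x: "x \<in> S"
      have "poly P x = (x - a) * poly Q x + poly P a"
        by (subst P) (simp add: algebra_simps)
      moreover have "p dvd poly P x" "p dvd poly P a"
        using insert.prems(3) x by auto
      ultimately have "p dvd (x - a) * poly Q x"
        by (metis dvd_add_left_iff)
      \<comment> \<open>Distinct residues make \<open>x - a\<close> invertible modulo
        \<open>p\<close>, so the root \<open>x\<close> passes on to \<open>Q\<close>.\<close>
      moreover have "\<not> p dvd x - a"
        using insert.prems(1) insert.hyps x by (auto simp: mod_eq_dvd_iff inj_on_def)
      ultimately show "p dvd poly Q x"
        using p prime_dvd_mult_iff by blast
    qed
  qed
  ultimately show ?case
    by (subst P) (intro dvd_add dvd_mult)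
qed

text \<open>Coefficient vectors, constant term first. Extensionality gives each polynomial a single
  representative. They serve as the sample space, whose points must have type
  \<open>nat \<Rightarrow> nat\<close> in \<open>entropic\<close>.\<close>

definition messages :: "nat \<Rightarrow> nat \<Rightarrow> (nat \<Rightarrow> nat) set" where
  "messages p k = {..<k} \<rightarrow>\<^sub>E {..<p}"

definition codeword :: "nat \<Rightarrow> nat \<Rightarrow> (nat \<Rightarrow> nat) \<Rightarrow> nat \<Rightarrow> nat" where
  "codeword p k \<omega> x = (\<Sum>j<k. \<omega> j * x ^ j) mod p"

lemma finite_messages: "finite (messages p k)"
  by (auto simp: messages_def intro: finite_PiE)

lemma card_messages: "card (messages p k) = p ^ k"
  by (simp add: messages_def card_PiE)

lemma messages_nonempty: "p > 0 \<Longrightarrow> messages p k \<noteq> {}"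
  by (auto simp: messages_def PiE_eq_empty_iff)

text \<open>The difference of the two polynomials has too many roots modulo \<open>p\<close> for its
  degree, so all its coefficients are multiples of \<open>p\<close>; coefficients taken from
  \<open>{..<p}\<close> then coincide.\<close>

lemma message_eqI:
  assumes p: "prime p" and T: "T \<subseteq> {..<p}" and card: "card T = k"
    and \<omega>: "\<omega> \<in> messages p k" and \<omega>': "\<omega>' \<in> messages p k"
    and eq: "\<And>x. x \<in> T \<Longrightarrow> codeword p k \<omega> x = codeword p k \<omega>' x"
  shows "\<omega> = \<omega>'"
proof (rule PiE_ext[OF \<omega>[unfolded messages_def] \<omega>'[unfolded messages_def]])
  fix i assume i: "i \<in> {..<k}"
  define P where "P = (\<Sum>j<k. monom (int (\<omega> j) - int (\<omega>' j)) j)"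
  have "[:int p:] dvd P"
  proof (rule const_poly_dvd_if_many_roots_mod_prime)
    show "prime (int p)"
      using p by simp
    show "finite (int ` T)"
      using T by (meson finite_imageI finite_lessThan finite_subset)
    show "inj_on (\<lambda>x. x mod int p) (int ` T)"
      using T by (auto simp: inj_on_def subset_eq)
    have "degree P \<le> k - 1"
      unfolding P_def by (intro degree_sum_le) (auto intro: order.trans[OF degree_monom_le])
    thus "degree P < card (int ` T)"
      using i card by (simp add: card_image)
    fix y assume "y \<in> int ` T"
    then obtain x where x: "x \<in> T" "y = int x"
      by auto
    have "int (\<Sum>j<k. \<omega> j * x ^ j) mod int p = int (\<Sum>j<k. \<omega>' j * x ^ j) mod int p"
      using eq[OF x(1)] unfolding codeword_def by (metis zmod_int)
    hence "int p dvd int (\<Sum>j<k. \<omega> j * x ^ j) - int (\<Sum>j<k. \<omega>' j * x ^ j)"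
      by (simp only: mod_eq_dvd_iff)
    also have "\<dots> = poly P y"
      by (simp add: P_def poly_sum poly_monom x sum_subtractf left_diff_distrib)
    finally show "int p dvd poly P y" .
  qed
  hence "int p dvd coeff P i"
    by (simp add: const_poly_dvd_iff)
  also have "coeff P i = int (\<omega> i) - int (\<omega>' i)"
    using i by (simp add: P_def coeff_sum)
  finally have "int (\<omega> i) mod int p = int (\<omega>' i) mod int p"
    by (simp add: mod_eq_dvd_iff)
  moreover have "\<omega> i < p" "\<omega>' i < p"
    using \<omega> \<omega>' i by (auto simp: messages_def PiE_iff)
  ultimately show "\<omega> i = \<omega>' i"
    by simp
qed

text \<open>Injectivity is uniqueness of interpolation; surjectivity follows by counting, since both
  sides have \<open>p ^ k\<close> elements.\<close>

lemma bij_betw_codeword: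
  assumes p: "prime p" and T: "T \<subseteq> {..<p}" and card: "card T = k"
  shows "bij_betw (\<lambda>\<omega>. \<lambda>x\<in>T. codeword p k \<omega> x) (messages p k) (T \<rightarrow>\<^sub>E {..<p})"
proof -
  let ?E = "\<lambda>\<omega>. \<lambda>x\<in>T. codeword p k \<omega> x"
  have fin: "finite T"
    using T finite_subset by blast
  have inj: "inj_on ?E (messages p k)"
  proof (rule inj_onI)
    fix \<omega> \<omega>'
    assume *: "\<omega> \<in> messages p k" "\<omega>' \<in> messages p k" and eq: "?E \<omega> = ?E \<omega>'"
    have "codeword p k \<omega> x = codeword p k \<omega>' x" if "x \<in> T" for x
      using fun_cong[OF eq, of x] that by simp
    thus "\<omega> = \<omega>'"
      using message_eqI[OF p T card] * by blast
  qed
  have "?E ` messages p k \<subseteq> T \<rightarrow>\<^sub>E {..<p}"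
    using prime_gt_0_nat[OF p] by (auto simp: codeword_def)
  moreover have "card (?E ` messages p k) = card (T \<rightarrow>\<^sub>E {..<p})"
    using card_image[OF inj] fin card by (simp add: card_messages card_PiE)
  ultimately have "?E ` messages p k = T \<rightarrow>\<^sub>E {..<p}"
    using fin by (intro card_subset_eq finite_PiE) auto
  thus ?thesis
    using inj by (simp add: bij_betw_def)
qed

(* Truncated subtraction is intended: if card T >= k, the fibre is the singleton {\<omega>}. *)
lemma card_codeword_fibre:
  assumes p: "prime p" and k: "k \<le> p" and T: "T \<subseteq> {..<p}" and \<omega>: "\<omega> \<in> messages p k"
  shows "card {\<omega>' \<in> messages p k. \<forall>x\<in>T. codeword p k \<omega>' x = codeword p k \<omega> x}
           = p ^ (k - card T)"
proof (cases "card T \<le> k")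
  case True
  \<comment> \<open>Padding \<open>T\<close> to exactly \<open>k\<close> points, possible since
    \<open>k \<le> p\<close>, makes evaluation a bijection. The fibre then corresponds to the value
    tuples that are fixed on \<open>T\<close> and free at the other \<open>k - card T\<close>
    points.\<close>
  obtain T' where T': "T \<subseteq> T'" "T' \<subseteq> {..<p}" "card T' = k"
    using exists_subset_between[of T k "{..<p}"] True k T by auto
  have fin: "finite T'"
    using T'(2) finite_subset by blast
  let ?E = "\<lambda>\<omega>'. \<lambda>x\<in>T'. codeword p k \<omega>' x"
  let ?F = "{\<omega>' \<in> messages p k. \<forall>x\<in>T. codeword p k \<omega>' x = codeword p k \<omega> x}"
  let ?G = "\<Pi>\<^sub>E x\<in>T'. if x \<in> T then {codeword p k \<omega> x} else {..<p}"
  note bij = bij_betw_codeword[OF p T'(2,3)]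
  have lt: "codeword p k \<omega>' x < p" for \<omega>' x
    using prime_gt_0_nat[OF p] by (simp add: codeword_def)
  have "?E ` ?F = ?G"
  proof
    show "?E ` ?F \<subseteq> ?G"
      using lt by (auto simp: PiE_iff)
    show "?G \<subseteq> ?E ` ?F"
    proof
      fix g assume g: "g \<in> ?G"
      hence "g \<in> T' \<rightarrow>\<^sub>E {..<p}"
        using lt by (auto simp: PiE_iff split: if_splits)
      then obtain \<omega>' where \<omega>': "\<omega>' \<in> messages p k" "g = ?E \<omega>'"
        using bij_betw_imp_surj_on[OF bij] by blast
      have "codeword p k \<omega>' x = codeword p k \<omega> x" if "x \<in> T" for x
        using g that T'(1) unfolding \<omega>'(2) by (force simp: PiE_iff)
      thus "g \<in> ?E ` ?F"
        using \<omega>' by blast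
    qed
  qed
  moreover have "inj_on ?E ?F"
    using bij by (auto simp: bij_betw_def intro: inj_on_subset)
  ultimately have "card ?F = card ?G"
    using card_image by fastforce
  also have "\<dots> = (\<Prod>x\<in>T'. if x \<in> T then 1 else p)"
    using fin by (simp add: card_PiE if_distrib cong: if_cong prod.cong)
  also have "\<dots> = p ^ card (T' - T)"
    using fin by (simp add: prod.If_cases Diff_eq)
  also have "card (T' - T) = k - card T"
    using T' fin by (simp add: card_Diff_subset finite_subset)
  finally show ?thesis .
next
  case False
  \<comment> \<open>Any \<open>k\<close> of the points in \<open>T\<close> already determine the
    message.\<close>
  then obtain T' where T': "T' \<subseteq> T" "card T' = k"
    by (meson nat_le_linear obtain_subset_with_card_n)
  have "{\<omega>' \<in> messages p k. \<forall>x\<in>T. codeword p k \<omega>' x = codeword p k \<omega> x} = {\<omega>}"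
    using message_eqI[OF p _ T'(2) _ \<omega>] T'(1) T \<omega> by blast
  thus ?thesis
    using False by simp
qed

section \<open>Coverage as a set of evaluation points\<close>

text \<open>Variables in \<open>entropic\<close> take values in \<open>nat\<close>, so the tuple of
  values is coded injectively by \<open>to_nat\<close>; sorting merely fixes an order of the
  points.\<close>

definition observation :: "nat \<Rightarrow> nat \<Rightarrow> (nat \<Rightarrow> nat set) \<Rightarrow> nat \<Rightarrow> (nat \<Rightarrow> nat) \<Rightarrow> nat" where
  "observation p k S i \<omega> = to_nat (map (codeword p k \<omega>) (sorted_list_of_set (S i)))"

lemma observation_eq_iff:
  assumes "finite (S i)"
  shows "observation p k S i \<omega> = observation p k S i \<omega>' \<longleftrightarrow>
           (\<forall>x\<in>S i. codeword p k \<omega> x = codeword p k \<omega>' x)"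
  using assms by (simp add: observation_def)

lemma subfamily_eq_iff:
  "subfamily X A \<omega> = subfamily X A \<omega>' \<longleftrightarrow> (\<forall>i\<in>A. X i \<omega> = X i \<omega>')"
  by (auto simp: subfamily_def restrict_def fun_eq_iff)

text \<open>Knowing the observations indexed by \<open>A\<close> amounts to knowing the codeword on
  the union of the \<open>S i\<close>, and points shared by several \<open>S i\<close> add nothing.
  The fibre count for this union gives the entropy.\<close>

lemma has_entropy_observations:
  assumes p: "prime p" and k: "k \<le> p" and S: "\<And>i. i \<in> A \<Longrightarrow> S i \<subseteq> {..<p}"
  shows "information_space.has_entropy (uniform_count_measure (messages p k)) 2
           (subfamily (observation p k S) A) (log 2 p * min (card (\<Union>i\<in>A. S i)) k)"
proof -
  let ?T = "\<Union>i\<in>A. S i"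
  have p1: "p > 1"
    using p by (rule prime_gt_1_nat)
  have fin: "finite (S i)" if "i \<in> A" for i
    using S[OF that] finite_subset by blast
  have "card {\<omega>' \<in> messages p k.
          subfamily (observation p k S) A \<omega>' = subfamily (observation p k S) A \<omega>}
        = p ^ (k - card ?T)" if "\<omega> \<in> messages p k" for \<omega>
  proof -
    have "?T \<subseteq> {..<p}"
      using S by blast
    from card_codeword_fibre[OF p k this that] show ?thesis
      by (simp add: subfamily_eq_iff observation_eq_iff fin)
  qed
  hence "information_space.has_entropy (uniform_count_measure (messages p k)) 2
           (subfamily (observation p k S) A)
           (log 2 (real (card (messages p k)) / real (p ^ (k - card ?T))))"
    using p1 by (intro has_entropy_equal_fibres finite_messages messages_nonempty) auto
  also have "log 2 (real (card (messages p k)) / real (p ^ (k - card ?T)))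
      = log 2 p * min (card ?T) k"
  proof -
    have "log 2 (real (card (messages p k)) / real (p ^ (k - card ?T)))
        = (real k - real (k - card ?T)) * log 2 p"
      using p1 by (simp add: card_messages log_divide log_nat_power left_diff_distrib)
    \<comment> \<open>Truncated subtraction produces the saturation: once \<open>card ?T\<close>
      reaches \<open>k\<close>, the subtrahend is 0.\<close>
    also have "real k - real (k - card ?T) = real (min (card ?T) k)"
      by linarith
    finally show ?thesis
      by (simp add: mult.commute)
  qed
  finally show ?thesis .
qed

text \<open>The blocks arise by numbering the disjoint union of the sets \<open>{..<m u}\<close>.
  Additivity of cardinality over every \<open>W\<close> is the form in which their disjointness is
  used.\<close>

lemma disjoint_blocks_exist:
  fixes m :: "'u \<Rightarrow> nat"
  assumes "finite U"
  obtains N and D :: "'u \<Rightarrow> nat set"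
  where "\<And>u. u \<in> U \<Longrightarrow> D u \<subseteq> {..<N}"
    and "\<And>W. W \<subseteq> U \<Longrightarrow> card (\<Union>u\<in>W. D u) = (\<Sum>u\<in>W. m u)"
proof -
  let ?B = "SIGMA u:U. {..<m u}"
  have "finite ?B"
    using assms by auto
  then obtain g where g: "bij_betw g ?B {0..<card ?B}"
    using ex_bij_betw_finite_nat by blast
  define D where "D u = g ` ({u} \<times> {..<m u})" for u
  show thesis
  proof (rule that)
    show "D u \<subseteq> {..<card ?B}" if "u \<in> U" for u
      using bij_betw_imp_surj_on[OF g] that by (fastforce simp: D_def)
    fix W assume W: "W \<subseteq> U"
    have "(\<Union>u\<in>W. D u) = g ` (SIGMA u:W. {..<m u})"
      by (auto simp: D_def)
    moreover have "inj_on g (SIGMA u:W. {..<m u})"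
      using W by (intro inj_on_subset[OF bij_betw_imp_inj_on[OF g]]) auto
    ultimately have "card (\<Union>u\<in>W. D u) = card (SIGMA u:W. {..<m u})"
      by (simp add: card_image)
    also have "\<dots> = (\<Sum>u\<in>W. m u)"
      using W assms finite_subset by (subst card_SigmaI) auto
    finally show "card (\<Union>u\<in>W. D u) = (\<Sum>u\<in>W. m u)" .
  qed
qed

theorem theorem5:
  fixes n :: nat
    and U :: "'u set"
    and w :: "'u \<Rightarrow> real"
    and V :: "nat \<Rightarrow> 'u set"
    and \<kappa> :: real
  assumes "n \<ge> 1"
    and "finite U"
    and "\<And>u. u \<in> U \<Longrightarrow> w u \<ge> 0"
    and "\<And>i. i \<in> {1..n} \<Longrightarrow> V i \<subseteq> U"
    and "\<kappa> \<ge> 0"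
    and "\<exists>s>0. s * \<kappa> \<in> \<int> \<and> (\<forall>u\<in>U. s * w u \<in> \<int>)"
  shows "entropic_up_to_constant n (saturated_coverage w V \<kappa>)"
proof -
  obtain s where s: "s > 0" "s * \<kappa> \<in> \<int>" "\<And>u. u \<in> U \<Longrightarrow> s * w u \<in> \<int>"
    using assms(6) by blast
  have "s * \<kappa> \<in> \<nat>"
    using s assms(5) by (simp add: Nats_altdef2)
  then obtain k where k: "s * \<kappa> = real k"
    by (auto elim: Nats_cases)
  have "\<exists>m. s * w u = real m" if "u \<in> U" for u
  proof -
    have "s * w u \<in> \<nat>"
      using s(1) s(3)[OF that] assms(3)[OF that] by (simp add: Nats_altdef2)
    thus ?thesis
      by (auto elim: Nats_cases)
  qed
  then obtain m where m: "\<And>u. u \<in> U \<Longrightarrow> s * w u = real (m u)"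
    by metis
  obtain N and D :: "'u \<Rightarrow> nat set"
    where D: "\<And>u. u \<in> U \<Longrightarrow> D u \<subseteq> {..<N}"
      and card_D: "\<And>W. W \<subseteq> U \<Longrightarrow> card (\<Union>u\<in>W. D u) = (\<Sum>u\<in>W. m u)"
    by (rule disjoint_blocks_exist[OF assms(2), of m]) blast
  \<comment> \<open>This size keeps the evaluation points below \<open>N\<close> distinct modulo
    \<open>p\<close> and ensures \<open>k \<le> p\<close>.\<close>
  obtain p where p: "prime p" "p > N + k"
    using bigger_prime by blast
  define S where "S i = (\<Union>u\<in>V i. D u)" for i
  define M where "M = uniform_count_measure (messages p k)"
  have S: "S i \<subseteq> {..<p}" if "i \<in> {1..n}" for i
    using D assms(4)[OF that] p(2) unfolding S_def by fastforce
  have "information_space.has_entropy M 2 (subfamily (observation p k S) A)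
          (s * log 2 p * saturated_coverage w V \<kappa> A)" if A: "A \<subseteq> {1..n}" for A
  proof -
    let ?W = "\<Union>i\<in>A. V i"
    have W: "?W \<subseteq> U"
      using A assms(4) by blast
    \<comment> \<open>An element \<open>u\<close> lying in several \<open>V i\<close> contributes
      the same block each time, hence is counted once, as in the coverage function.\<close>
    have "(\<Union>i\<in>A. S i) = (\<Union>u\<in>?W. D u)"
      by (auto simp: S_def)
    hence "real (card (\<Union>i\<in>A. S i)) = (\<Sum>u\<in>?W. real (m u))"
      using card_D[OF W] by simp
    also have "\<dots> = (\<Sum>u\<in>?W. s * w u)"
      using W m by (intro sum.cong) auto
    finally have "real (min (card (\<Union>i\<in>A. S i)) k) = s * saturated_coverage w V \<kappa> A"
      using s(1) k by (simp add: saturated_coverage_def of_nat_min sum_distrib_left min_mult_distrib_left)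
    moreover have "information_space.has_entropy M 2 (subfamily (observation p k S) A)
        (log 2 p * min (card (\<Union>i\<in>A. S i)) k)"
      unfolding M_def
    proof (rule has_entropy_observations[OF p(1)])
      show "k \<le> p"
        using p(2) by simp
      show "S i \<subseteq> {..<p}" if "i \<in> A" for i
        using S A that by blast
    qed
    ultimately show ?thesis
      by (simp add: mult_ac)
  qed
  moreover have "information_space M 2"
    unfolding M_def using p
    by (intro information_space_uniform_count_measure finite_messages messages_nonempty) auto
  moreover have "observation p k S i \<in> M \<rightarrow>\<^sub>M count_space UNIV" for i
    by (auto simp: M_def measurable_def sets_uniform_count_measure space_uniform_count_measure)
  \<comment> \<open>The constant combines \<open>s\<close>, which makes the data integral, with
    \<open>log 2 p\<close>, the entropy in bits of one uniform symbol from
    \<open>{..<p}\<close>.\<close>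
  ultimately have "entropic n (\<lambda>A. s * log 2 p * saturated_coverage w V \<kappa> A)"
    unfolding entropic_def by blast
  moreover have "s * log 2 p > 0"
    using s(1) prime_gt_1_nat[OF p(1)] by simp
  ultimately show ?thesis
    unfolding entropic_up_to_constant_def by blast
qed

end
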